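(* Assume there exist constants $\gamma_1,\gamma_2,\gamma_3,\gamma_4$ such that for all $x,y,x_1,x_2,y_1,y_2\in\mathbb{R}^d$ $$\langle x_2-x_1,f(x_2,y)-f(x_1,y)\rangle\le\gamma_1|x_2-x_1|^2,$$ $$|f(x,y_2)-f(x,y_1)|\le\gamma_2|y_2-y_1|,$$ $$|g(x_2,y_2)-g(x_1,y_1)|^2\le\gamma_3|x_2-x_1|^2+\gamma_4|y_2-y_1|^2,$$ and that the delay is bounded: there is $\tau>0$ with $0\le\tau(t)\le\tau$ for all $t\ge0$. For a stepsize $h>0$ write $\tau=(\kappa-\delta)h$ with an integer $\kappa\ge1$ and $0\le\delta<1$. If $$\beta:=2\gamma_1+2\gamma_2+\gamma_3+\gamma_4<0,$$ then for every $h>0$, any two solutions $X_n,Y_n$ produced by the SSBE method with stepsize $h$ from initial data $\psi$ and $\phi$ respectively, where $\mathbb{E}\|\psi\|^2<\infty$ and $\mathbb{E}\|\phi\|^2<\infty$, satisfy $$\mathbb{E}|X_n-Y_n|^2\le\mathbb{E}\|\phi-\psi\|^2\exp\{-\nu_h^+nh\}\quad\text{for all sufficiently large }n,$$ where $$\nu_h^+=\frac{1}{2(\kappa+1)h}\ln\left(\frac{1-2h\gamma_1-h\gamma_2}{1+h\gamma_2+h\gamma_3+h\gamma_4}\right)>0.$$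
   Context: $|\cdot|$ denotes the Euclidean norm on $\mathbb{R}^d$ and the trace (Frobenius) norm on $\mathbb{R}^{d\times m}$; $\|\psi\|:=\sup_{-\tau\le s\le0}|\psi(s)|$, so $\mathbb{E}\|\psi\|^2=\mathbb{E}\sup_{-\tau\le s\le0}|\psi(s)|^2$. $f:\mathbb{R}^d\times\mathbb{R}^d\to\mathbb{R}^d$ is continuously differentiable in both arguments, $g:\mathbb{R}^d\times\mathbb{R}^d\to\mathbb{R}^{d\times m}$; $w$ is an $m$-dimensional Wiener process on a complete filtered probability space $(\Omega,\mathcal F,\{\mathcal F_t\}_{t\ge0},\mathbb P)$ satisfying the usual conditions. Initial data are $\mathcal F_0$-measurable random functions on $[-\tau,0]$ with continuous paths, independent of $w$. SSBE (split-step backward Euler) method for the It\^o SDDE $dx(t)=f(x(t),x(t-\tau(t)))\,dt+g(x(t),x(t-\tau(t)))\,dw(t)$, $x=\psi$ on $[-\tau,0]$, with stepsize $h>0$, $t_n=nh$, $\Delta w_n=w(t_{n+1})-w(t_n)$, $y_0=\psi(0)$: for $n=0,1,2,\dots$ $$y_n^*=y_n+hf(y_n^*,\tilde y_n^* ),\qquad y_{n+1}=y_n^*+g(y_n^*,\tilde y_n^* )\Delta w_n,$$ where $\tilde y_n^*=\psi(t_n-\tau(t_n))$ if $t_n-\tau(t_n)<0$, and $\tilde y_n^*=\mu\,y^*_{n-q_n+1}+(1-\mu)\,y^*_{n-q_n}$ if $0\le t_n-\tau(t_n)\in[t_{n-q_n},t_{n-q_n+1})$ with $q_n\ge1$ an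 integer. Here $0\le\mu<1$ is either $\mu\equiv0$ (piecewise constant interpolation) or, for each $n$, the number with $t_n-\tau(t_n)=(1-\mu)t_{n-q_n}+\mu t_{n-q_n+1}$ (piecewise linear interpolation). If $\tau(t_n)=0$, then $\tilde y_n^*=y_n^*$. The variables $y_n,y_n^*$ are $\mathcal F_{t_n}$-measurable. The sequence $X_n$ (resp. $Y_n$) is $y_n$ computed with initial data $\psi$ (resp. $\phi$); both use the same $w$, the same $h$ and the same interpolation. *)

theory Defs
  imports "HOL-Probability.Probability"
begin

text \<open>
  Only the times \<open>t \<ge> 0\<close> of the family \<open>F\<close> matter. The base space is complete and \<open>F 0\<close>
  contains every null set, so \<open>F\<close> satisfies the usual conditions.
\<close>
definition usual_filtration :: "'a measure \<Rightarrow> (real \<Rightarrow> 'a measure) \<Rightarrow> bool" where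
  "usual_filtration M F \<longleftrightarrow>
     complete_measure M \<and>
     (\<forall>t\<ge>0. subalgebra M (F t)) \<and>
     (\<forall>s\<ge>0. \<forall>t\<ge>s. sets (F s) \<subseteq> sets (F t)) \<and>
     (\<forall>t\<ge>0. sets (F t) = (\<Inter>u\<in>{t<..}. sets (F u))) \<and>
     null_sets M \<subseteq> sets (F 0)"

definition wiener_process ::
  "'a measure \<Rightarrow> (real \<Rightarrow> 'a measure) \<Rightarrow> (real \<Rightarrow> 'a \<Rightarrow> real^'m) \<Rightarrow> bool" where
  "wiener_process M F w \<longleftrightarrow>
     (\<forall>t\<ge>0. w t \<in> borel_measurable (F t)) \<and>
     (AE \<omega> in M. w 0 \<omega> = 0) \<and>
     (AE \<omega> in M. continuous_on {0..} (\<lambda>t. w t \<omega>)) \<and>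
     (\<forall>s\<ge>0. \<forall>t>s.
        prob_space.indep_set M (sets (F s))
          (sets (vimage_algebra (space M) (\<lambda>\<omega>. w t \<omega> - w s \<omega>) borel)) \<and>
        prob_space.indep_vars M (\<lambda>_. borel) (\<lambda>i \<omega>. (w t \<omega> - w s \<omega>) $ i) UNIV \<and>
        (\<forall>i. distributed M lborel (\<lambda>\<omega>. (w t \<omega> - w s \<omega>) $ i)
               (\<lambda>x. ennreal (normal_density 0 (sqrt (t - s)) x))))"

text \<open>The sigma-algebra generated by the process \<open>X\<close> restricted to the time set \<open>I\<close>.\<close>
definition process_sigma :: "'a measure \<Rightarrow> real set \<Rightarrow> (real \<Rightarrow> 'a \<Rightarrow> 'b::topological_space) \<Rightarrow> 'a measure" where
  "process_sigma M I X =
     vimage_algebra (space M) (\<lambda>\<omega>. \<lambda>t\<in>I. X t \<omega>) (\<Pi>\<^sub>M t\<in>I. borel)"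

definition initial_datum ::
  "'a measure \<Rightarrow> (real \<Rightarrow> 'a measure) \<Rightarrow> (real \<Rightarrow> 'a \<Rightarrow> real^'m) \<Rightarrow> real
     \<Rightarrow> (real \<Rightarrow> 'a \<Rightarrow> real^'d) \<Rightarrow> bool" where
  "initial_datum M F w \<tau> \<psi> \<longleftrightarrow>
     (\<forall>t\<in>{-\<tau>..0}. \<psi> t \<in> borel_measurable (F 0)) \<and>
     (\<forall>\<omega>\<in>space M. continuous_on {-\<tau>..0} (\<lambda>t. \<psi> t \<omega>)) \<and>
     prob_space.indep_set M (sets (process_sigma M {-\<tau>..0} \<psi>)) (sets (process_sigma M {0..} w))"

definition path_norm :: "real \<Rightarrow> (real \<Rightarrow> 'b::real_normed_vector) \<Rightarrow> real" where
  "path_norm \<tau> u = (SUP s\<in>{-\<tau>..0}. norm (u s))"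

text \<open>
  The mean square \<open>E Z\<^sup>2\<close> takes values in \<open>[0, \<infinity>]\<close>, so a bound on it includes its finiteness
  (the Bochner integral of a non-integrable function would be 0).
\<close>
definition mean_sq :: "'a measure \<Rightarrow> ('a \<Rightarrow> real) \<Rightarrow> ennreal" where
  "mean_sq M Z = (\<integral>\<^sup>+ \<omega>. ennreal ((Z \<omega>)\<^sup>2) \<partial>M)"

definition cont_diff :: "('a::real_normed_vector \<Rightarrow> 'b::real_normed_vector \<Rightarrow> 'c::real_normed_vector) \<Rightarrow> bool" where
  "cont_diff f \<longleftrightarrow>
     (\<exists>f' :: 'a \<times> 'b \<Rightarrow> ('a \<times> 'b) \<Rightarrow>\<^sub>L 'c.
        (\<forall>p. ((\<lambda>(x, y). f x y) has_derivative blinfun_apply (f' p)) (at p)) \<and>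
        continuous_on UNIV f')"

definition grid :: "real \<Rightarrow> nat \<Rightarrow> real" where
  "grid h n = real n * h"

text \<open>
  \<open>q n\<close> and \<open>\<mu> n\<close> locate the retarded time \<open>t\<^sub>n - \<tau>(t\<^sub>n)\<close> on the grid. They are constrained only
  where the method uses them, that is, where the retarded time is nonnegative and the delay is
  nonzero. The two disjuncts are piecewise constant and piecewise linear interpolation.
\<close>
definition interpolation :: "real \<Rightarrow> (real \<Rightarrow> real) \<Rightarrow> (nat \<Rightarrow> nat) \<Rightarrow> (nat \<Rightarrow> real) \<Rightarrow> bool" where
  "interpolation h dl q \<mu> \<longleftrightarrow>
     (\<forall>n. 0 \<le> grid h n - dl (grid h n) \<and> dl (grid h n) \<noteq> 0 \<longrightarrow>
        1 \<le> q n \<and> q n \<le> n \<and>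
        grid h n - dl (grid h n) \<in> {grid h (n - q n)..<grid h (n - q n + 1)}) \<and>
     (\<forall>n. 0 \<le> \<mu> n \<and> \<mu> n < 1) \<and>
     ((\<forall>n. \<mu> n = 0) \<or>
      (\<forall>n. 0 \<le> grid h n - dl (grid h n) \<and> dl (grid h n) \<noteq> 0 \<longrightarrow>
         grid h n - dl (grid h n) = (1 - \<mu> n) * grid h (n - q n) + \<mu> n * grid h (n - q n + 1)))"

text \<open>The delayed stage value; for \<open>q n = 1\<close> it contains the implicit unknown \<open>ys n\<close>.\<close>
definition ssbe_delayed ::
  "real \<Rightarrow> (real \<Rightarrow> real) \<Rightarrow> (nat \<Rightarrow> nat) \<Rightarrow> (nat \<Rightarrow> real) \<Rightarrow> (real \<Rightarrow> 'a \<Rightarrow> real^'d)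
     \<Rightarrow> (nat \<Rightarrow> 'a \<Rightarrow> real^'d) \<Rightarrow> nat \<Rightarrow> 'a \<Rightarrow> real^'d" where
  "ssbe_delayed h dl q \<mu> \<psi> ys n \<omega> =
     (if grid h n - dl (grid h n) < 0 then \<psi> (grid h n - dl (grid h n)) \<omega>
      else if dl (grid h n) = 0 then ys n \<omega>
      else \<mu> n *\<^sub>R ys (n - q n + 1) \<omega> + (1 - \<mu> n) *\<^sub>R ys (n - q n) \<omega>)"

text \<open>\<open>y\<close> is the sequence of approximations and \<open>ys\<close> that of the stage values \<open>y\<^sub>n\<^sup>*\<close>.\<close>
definition ssbe_solution ::
  "'a measure \<Rightarrow> (real \<Rightarrow> 'a measure) \<Rightarrow> (real^'d \<Rightarrow> real^'d \<Rightarrow> real^'d)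
     \<Rightarrow> (real^'d \<Rightarrow> real^'d \<Rightarrow> real^'m^'d) \<Rightarrow> (real \<Rightarrow> 'a \<Rightarrow> real^'m)
     \<Rightarrow> real \<Rightarrow> (real \<Rightarrow> real) \<Rightarrow> (nat \<Rightarrow> nat) \<Rightarrow> (nat \<Rightarrow> real) \<Rightarrow> (real \<Rightarrow> 'a \<Rightarrow> real^'d)
     \<Rightarrow> (nat \<Rightarrow> 'a \<Rightarrow> real^'d) \<Rightarrow> (nat \<Rightarrow> 'a \<Rightarrow> real^'d) \<Rightarrow> bool" where
  "ssbe_solution M F f g w h dl q \<mu> \<psi> y ys \<longleftrightarrow>
     (\<forall>n. y n \<in> borel_measurable (F (grid h n)) \<and> ys n \<in> borel_measurable (F (grid h n))) \<and>
     (AE \<omega> in M. y 0 \<omega> = \<psi> 0 \<omega>) \<and>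
     (\<forall>n. AE \<omega> in M.
        ys n \<omega> = y n \<omega> + h *\<^sub>R f (ys n \<omega>) (ssbe_delayed h dl q \<mu> \<psi> ys n \<omega>) \<and>
        y (Suc n) \<omega> = ys n \<omega> +
          g (ys n \<omega>) (ssbe_delayed h dl q \<mu> \<psi> ys n \<omega>) *v
            (w (grid h (Suc n)) \<omega> - w (grid h n) \<omega>))"

definition nu_plus :: "real \<Rightarrow> nat \<Rightarrow> real \<Rightarrow> real \<Rightarrow> real \<Rightarrow> real \<Rightarrow> real" where
  "nu_plus h \<kappa> \<gamma>1 \<gamma>2 \<gamma>3 \<gamma>4 =
     1 / (2 * (real \<kappa> + 1) * h) *
       ln ((1 - 2 * h * \<gamma>1 - h * \<gamma>2) / (1 + h * \<gamma>2 + h * \<gamma>3 + h * \<gamma>4))"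

end

(*
Write u_n and v_n for the mean squares of X*_n - Y*_n and X_n - Y_n, and N for that of the initial
difference. The one-sided Lipschitz condition in the implicit stage gives
(1 - 2 h gamma1 - h gamma2) u_n <= v_n + h gamma2 p_n, where p_n is the mean square of the delayed
difference; independence of the Wiener increment gives
v_(n+1) <= (1 + h gamma3) u_n + h gamma4 p_n. The delayed value is a convex combination of the
current stage value (which may enter, the step being implicit) and of at most kappa earlier ones, or
it is an initial value. Hence u_n <= rho * max (u_(n-kappa-1), ..., u_(n-1)), with u_k read as N for
k < 0 and rho = exp (-2 (kappa + 1) h nu) < 1. So v_n decays like rho^(n div (kappa + 1)), at rate
2 nu; for large n the halved rate nu absorbs the constants.
*)
theory Submission
  imports Defs
begin

section \<open>Mean squares under an independent centred increment\<close>

text \<open>Bridges from independence of sigma-algebras, the form in which the Wiener process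
  supplies it, to independence of random variables, the form that the product rule for expectations
  takes. The sigma-algebras generated by \<open>U\<close> and by \<open>\<Phi> (Z \<omega>)\<close>
  lie inside the two given ones, and independence passes to smaller families.\<close>

lemma (in prob_space) indep_var_of_indep_set:
  fixes U :: "'a \<Rightarrow> real" and \<Phi> :: "'b::topological_space \<Rightarrow> real"
  assumes ind: "indep_set (sets \<G>) (sets (vimage_algebra (space M) Z borel))"
    and sub: "subalgebra M \<G>"
    and Z: "Z \<in> borel_measurable M"
    and U: "U \<in> borel_measurable \<G>" and \<Phi>: "\<Phi> \<in> borel_measurable borel"
  shows "indep_var borel U borel (\<lambda>\<omega>. \<Phi> (Z \<omega>))"
proof -
  have sp: "space \<G> = space M"
    using sub by (simp add: subalgebra_def)
  have Z': "Z \<in> vimage_algebra (space M) Z borel \<rightarrow>\<^sub>M borel"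
    by (rule measurable_vimage_algebra1) simp
  have 1: "{U -` B \<inter> space M |B. B \<in> sets borel} \<subseteq> sets \<G>"
    using measurable_sets[OF U] sp by auto
  have 2: "{(\<lambda>\<omega>. \<Phi> (Z \<omega>)) -` B \<inter> space M |B. B \<in> sets borel}
      \<subseteq> sets (vimage_algebra (space M) Z borel)"
    using measurable_sets[OF measurable_compose[OF Z' \<Phi>]] by auto
  have 3: "sigma_sets (space M) {U -` B \<inter> space M |B. B \<in> sets borel} \<subseteq> sets \<G>"
    using sets.sigma_sets_subset[OF 1] sp by simp
  have 4: "sigma_sets (space M) {(\<lambda>\<omega>. \<Phi> (Z \<omega>)) -` B \<inter> space M |B. B \<in> sets borel}
      \<subseteq> sets (vimage_algebra (space M) Z borel)"
    using sets.sigma_sets_subset[OF 2] by simp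
  have "indep_set (sigma_sets (space M) {U -` B \<inter> space M |B. B \<in> sets borel})
     (sigma_sets (space M) {(\<lambda>\<omega>. \<Phi> (Z \<omega>)) -` B \<inter> space M |B. B \<in> sets borel})"
    using ind 3 4 unfolding indep_sets2_eq by blast
  moreover have "random_variable borel U"
    using measurable_from_subalg[OF sub U] .
  moreover have "random_variable borel (\<lambda>\<omega>. \<Phi> (Z \<omega>))"
    using measurable_compose[OF Z \<Phi>] .
  ultimately show ?thesis
    unfolding indep_var_eq by blast
qed

lemma borel_measurable_vec_nth [measurable (raw)]:
  fixes u :: "'a \<Rightarrow> 'b::topological_space^'n"
  assumes "u \<in> borel_measurable M"
  shows "(\<lambda>\<omega>. u \<omega> $ i) \<in> borel_measurable M"
  using measurable_compose[OF assms borel_measurable_continuous_onI[of "\<lambda>x. x $ i"]]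
  by (simp add: continuous_on_component)

lemma norm_sq_vec: "(norm (x :: real^'n))\<^sup>2 = (\<Sum>i\<in>UNIV. (x $ i)\<^sup>2)"
  by (simp add: norm_vec_def L2_set_def sum_nonneg)

lemma norm_sq_matrix: "(norm (A :: real^'m^'n))\<^sup>2 = (\<Sum>i\<in>UNIV. \<Sum>j\<in>UNIV. (A $ i $ j)\<^sup>2)"
  by (simp add: norm_vec_def L2_set_def sum_nonneg)

text \<open>The coordinate expansion writes every term as a factor in \<open>a\<close> and
  \<open>A\<close> times a factor in \<open>z\<close>, so that independence can be applied term by
  term.\<close>

lemma norm_sq_add_matrix_vector_mult:
  fixes a :: "real^'n" and A :: "real^'m^'n" and z :: "real^'m"
  shows "(norm (a + A *v z))\<^sup>2 = (norm a)\<^sup>2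
    + 2 * (\<Sum>i\<in>UNIV. \<Sum>j\<in>UNIV. (a $ i * A $ i $ j) * z $ j)
    + (\<Sum>i\<in>UNIV. \<Sum>j\<in>UNIV. \<Sum>k\<in>UNIV. (A $ i $ j * A $ i $ k) * (z $ j * z $ k))"
proof -
  have "(norm (a + A *v z))\<^sup>2
      = (\<Sum>i\<in>UNIV. (a $ i)\<^sup>2 + 2 * (\<Sum>j\<in>UNIV. (a $ i * A $ i $ j) * z $ j)
        + (\<Sum>j\<in>UNIV. \<Sum>k\<in>UNIV. (A $ i $ j * A $ i $ k) * (z $ j * z $ k)))"
    unfolding norm_sq_vec
  proof (rule sum.cong)
    fix i
    have "((A *v z) $ i)\<^sup>2 = (\<Sum>j\<in>UNIV. \<Sum>k\<in>UNIV. (A $ i $ j * A $ i $ k) * (z $ j * z $ k))"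
      by (simp add: matrix_vector_mult_def power2_eq_square sum_product mult_ac)
    moreover have "a $ i * (A *v z) $ i = (\<Sum>j\<in>UNIV. (a $ i * A $ i $ j) * z $ j)"
      by (simp add: matrix_vector_mult_def sum_distrib_left mult_ac)
    ultimately show "((a + A *v z) $ i)\<^sup>2 = (a $ i)\<^sup>2 + 2 * (\<Sum>j\<in>UNIV. (a $ i * A $ i $ j) * z $ j)
        + (\<Sum>j\<in>UNIV. \<Sum>k\<in>UNIV. (A $ i $ j * A $ i $ k) * (z $ j * z $ k))"
      by (simp add: power2_sum)
  qed simp
  then show ?thesis
    by (simp add: norm_sq_vec sum.distrib sum_distrib_left)
qed

lemma integrable_mult_of_squares:
  fixes u v :: "'a \<Rightarrow> real"
  assumes "u \<in> borel_measurable M" "v \<in> borel_measurable M"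
    and "integrable M (\<lambda>\<omega>. (u \<omega>)\<^sup>2)" "integrable M (\<lambda>\<omega>. (v \<omega>)\<^sup>2)"
  shows "integrable M (\<lambda>\<omega>. u \<omega> * v \<omega>)"
proof (rule Bochner_Integration.integrable_bound[of M "\<lambda>\<omega>. (u \<omega>)\<^sup>2 + (v \<omega>)\<^sup>2"])
  show "AE \<omega> in M. norm (u \<omega> * v \<omega>) \<le> norm ((u \<omega>)\<^sup>2 + (v \<omega>)\<^sup>2)"
  proof (rule AE_I2)
    fix \<omega>
    have "2 * (\<bar>u \<omega>\<bar> * \<bar>v \<omega>\<bar>) \<le> (u \<omega>)\<^sup>2 + (v \<omega>)\<^sup>2"
      using sum_squares_bound[of "\<bar>u \<omega>\<bar>" "\<bar>v \<omega>\<bar>"] by simp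
    moreover have "0 \<le> \<bar>u \<omega>\<bar> * \<bar>v \<omega>\<bar>" by simp
    ultimately have "\<bar>u \<omega>\<bar> * \<bar>v \<omega>\<bar> \<le> (u \<omega>)\<^sup>2 + (v \<omega>)\<^sup>2" by linarith
    then show "norm (u \<omega> * v \<omega>) \<le> norm ((u \<omega>)\<^sup>2 + (v \<omega>)\<^sup>2)" by (simp add: abs_mult)
  qed
qed (use assms in auto)

text \<open>The Ito isometry for one step: the cross terms vanish because \<open>Z\<close> is
  centred and independent of \<open>\<G>\<close>, and the covariance \<open>v\<close> times the
  identity turns the quadratic term into \<open>v\<close> times the squared Frobenius norm. Stating
  it for extended integrals allows its use before second moments are known to be finite.\<close>

lemma (in prob_space) nn_integral_norm_sq_add_indep:
  fixes A :: "'a \<Rightarrow> real^'n" and G :: "'a \<Rightarrow> real^'m^'n" and Z :: "'a \<Rightarrow> real^'m"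
  assumes ind: "indep_set (sets \<G>) (sets (vimage_algebra (space M) Z borel))"
    and sub: "subalgebra M \<G>"
    and Z: "Z \<in> borel_measurable M"
    and A: "A \<in> borel_measurable \<G>" and G: "G \<in> borel_measurable \<G>"
    and int1: "\<And>i. integrable M (\<lambda>\<omega>. Z \<omega> $ i)"
    and int2: "\<And>i j. integrable M (\<lambda>\<omega>. Z \<omega> $ i * Z \<omega> $ j)"
    and mean: "\<And>i. expectation (\<lambda>\<omega>. Z \<omega> $ i) = 0"
    and cov: "\<And>i j. expectation (\<lambda>\<omega>. Z \<omega> $ i * Z \<omega> $ j) = (if i = j then v else 0)"
    and v: "v > 0"
  shows "(\<integral>\<^sup>+ \<omega>. ennreal ((norm (A \<omega> + G \<omega> *v Z \<omega>))\<^sup>2) \<partial>M)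
    \<le> (\<integral>\<^sup>+ \<omega>. ennreal ((norm (A \<omega>))\<^sup>2) \<partial>M) + ennreal v * (\<integral>\<^sup>+ \<omega>. ennreal ((norm (G \<omega>))\<^sup>2) \<partial>M)"
proof (cases "(\<integral>\<^sup>+ \<omega>. ennreal ((norm (A \<omega>))\<^sup>2) \<partial>M) = \<infinity> \<or> (\<integral>\<^sup>+ \<omega>. ennreal ((norm (G \<omega>))\<^sup>2) \<partial>M) = \<infinity>")
  case True
  \<comment> \<open>Positivity of \<open>v\<close> matters: \<open>0 * \<infinity>\<close> is
    \<open>0\<close> in \<open>ennreal\<close>, so an infinite integral for \<open>G\<close> makes
    the right side infinite only when its coefficient is positive.\<close>
  then show ?thesis using v by (auto simp: ennreal_mult_top)
next
  case False
  note [measurable] = measurable_from_subalg[OF sub A] measurable_from_subalg[OF sub G] Z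
    A G
  have intA: "integrable M (\<lambda>\<omega>. (norm (A \<omega>))\<^sup>2)"
    using False by (intro integrableI_nonneg) (auto simp: top.not_eq_extremum)
  have intG: "integrable M (\<lambda>\<omega>. (norm (G \<omega>))\<^sup>2)"
    using False by (intro integrableI_nonneg) (auto simp: top.not_eq_extremum)
  have Ai: "integrable M (\<lambda>\<omega>. (A \<omega> $ i)\<^sup>2)" for i
  proof (rule Bochner_Integration.integrable_bound[OF intA])
    show "AE \<omega> in M. norm ((A \<omega> $ i)\<^sup>2) \<le> norm ((norm (A \<omega>))\<^sup>2)"
      by (rule AE_I2) (simp add: component_le_norm_cart flip: abs_le_square_iff)
  qed measurable
  have Gij: "integrable M (\<lambda>\<omega>. (G \<omega> $ i $ j)\<^sup>2)" for i j
  proof (rule Bochner_Integration.integrable_bound[OF intG])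
    show "AE \<omega> in M. norm ((G \<omega> $ i $ j)\<^sup>2) \<le> norm ((norm (G \<omega>))\<^sup>2)"
    proof (rule AE_I2)
      fix \<omega>
      have "\<bar>G \<omega> $ i $ j\<bar> \<le> norm (G \<omega>)"
        using component_le_norm_cart[of "G \<omega> $ i" j] Finite_Cartesian_Product.norm_nth_le[of "G \<omega>" i] by linarith
      then show "norm ((G \<omega> $ i $ j)\<^sup>2) \<le> norm ((norm (G \<omega>))\<^sup>2)"
        by (simp flip: abs_le_square_iff)
    qed
  qed measurable
  \<comment> \<open>The product rule for independent variables asks for integrability of each
    factor; square integrability of the components of \<open>A\<close> and \<open>G\<close> supplies
    it for their pairwise products.\<close>
  have AG: "integrable M (\<lambda>\<omega>. A \<omega> $ i * G \<omega> $ i $ j)" for i j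
    by (rule integrable_mult_of_squares) (use Ai Gij in auto)
  have GG: "integrable M (\<lambda>\<omega>. G \<omega> $ i $ j * G \<omega> $ i $ k)" for i j k
    by (rule integrable_mult_of_squares) (use Gij in auto)
  have ind1: "indep_var borel (\<lambda>\<omega>. A \<omega> $ i * G \<omega> $ i $ j) borel (\<lambda>\<omega>. Z \<omega> $ j)" for i j
    by (rule indep_var_of_indep_set[OF ind sub Z, where \<Phi> = "\<lambda>z. z $ j"]) measurable
  have ind2: "indep_var borel (\<lambda>\<omega>. G \<omega> $ i $ j * G \<omega> $ i $ k) borel (\<lambda>\<omega>. Z \<omega> $ j * Z \<omega> $ k)" for i j k
    by (rule indep_var_of_indep_set[OF ind sub Z, where \<Phi> = "\<lambda>z. z $ j * z $ k"]) measurable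
  note i1 = indep_var_integrable[OF ind1 AG int1] and i2 = indep_var_integrable[OF ind2 GG int2]
  note e1 = indep_var_lebesgue_integral[OF ind1 AG int1]
    and e2 = indep_var_lebesgue_integral[OF ind2 GG int2]
  have int: "integrable M (\<lambda>\<omega>. (norm (A \<omega> + G \<omega> *v Z \<omega>))\<^sup>2)"
    unfolding norm_sq_add_matrix_vector_mult using intA i1 i2 by auto
  have "expectation (\<lambda>\<omega>. (norm (A \<omega> + G \<omega> *v Z \<omega>))\<^sup>2) =
      expectation (\<lambda>\<omega>. (norm (A \<omega>))\<^sup>2)
      + 2 * (\<Sum>i\<in>UNIV. \<Sum>j\<in>UNIV. expectation (\<lambda>\<omega>. (A \<omega> $ i * G \<omega> $ i $ j) * Z \<omega> $ j))
      + (\<Sum>i\<in>UNIV. \<Sum>j\<in>UNIV. \<Sum>k\<in>UNIV. expectation (\<lambda>\<omega>. (G \<omega> $ i $ j * G \<omega> $ i $ k) * (Z \<omega> $ j * Z \<omega> $ k)))"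
    unfolding norm_sq_add_matrix_vector_mult using intA i1 i2 by simp
  also have "\<dots> = expectation (\<lambda>\<omega>. (norm (A \<omega>))\<^sup>2)
      + (\<Sum>i\<in>UNIV. \<Sum>j\<in>UNIV. expectation (\<lambda>\<omega>. (G \<omega> $ i $ j)\<^sup>2) * v)"
    unfolding e1 e2 mean cov by (simp add: power2_eq_square if_distrib cong: if_cong)
  also have "\<dots> = expectation (\<lambda>\<omega>. (norm (A \<omega>))\<^sup>2) + v * expectation (\<lambda>\<omega>. (norm (G \<omega>))\<^sup>2)"
    unfolding norm_sq_matrix using Gij by (simp add: sum_distrib_left mult.commute)
  finally show ?thesis
    using v by (simp add: nn_integral_eq_integral int intA intG ennreal_plus[symmetric]
        ennreal_mult[symmetric] del: ennreal_plus)
qed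

section \<open>Pointwise estimates for drift, interpolation and diffusion\<close>

text \<open>Pair the difference of the two stage equations with \<open>x - y\<close> itself. The
  one-sided condition controls the change in the first argument of \<open>f\<close>, the Lipschitz
  condition that in the second, and the remaining products are split by
  \<open>2 * a * b \<le> a^2 + b^2\<close>.\<close>

lemma implicit_stage_bound:
  fixes x y u v x' y' :: "'a::real_inner" and f :: "'a \<Rightarrow> 'a \<Rightarrow> 'a"
  assumes one_sided: "\<And>x1 x2 y. (x2 - x1) \<bullet> (f x2 y - f x1 y) \<le> \<gamma>1 * (norm (x2 - x1))\<^sup>2"
    and lip: "\<And>x y1 y2. norm (f x y2 - f x y1) \<le> \<gamma>2 * norm (y2 - y1)"
    and "h > 0" and "0 \<le> \<gamma>2"
    and x: "x = u + h *\<^sub>R f x x'" and y: "y = v + h *\<^sub>R f y y'"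
  shows "(1 - 2 * h * \<gamma>1 - h * \<gamma>2) * (norm (x - y))\<^sup>2
    \<le> (norm (u - v))\<^sup>2 + h * \<gamma>2 * (norm (x' - y'))\<^sup>2"
proof -
  define d where "d = x - y"
  \<comment> \<open>The mixed value \<open>f y x'\<close> is inserted so that each difference of
    \<open>f\<close> changes one argument only.\<close>
  have "d = (u - v) + h *\<^sub>R (f x x' - f y x') + h *\<^sub>R (f y x' - f y y')"
    using x y by (simp add: d_def algebra_simps)
  then have "d \<bullet> d = d \<bullet> (u - v) + h * (d \<bullet> (f x x' - f y x')) + h * (d \<bullet> (f y x' - f y y'))"
    by (metis inner_add_right inner_scaleR_right)
  moreover have "2 * (d \<bullet> (u - v)) \<le> (norm d)\<^sup>2 + (norm (u - v))\<^sup>2"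
    using norm_cauchy_schwarz[of d "u - v"] sum_squares_bound[of "norm d" "norm (u - v)"] by linarith
  moreover have "h * (d \<bullet> (f x x' - f y x')) \<le> h * (\<gamma>1 * (norm d)\<^sup>2)"
    using one_sided[of x y x'] \<open>h > 0\<close> by (simp add: d_def)
  moreover have "h * (2 * (d \<bullet> (f y x' - f y y'))) \<le> h * (\<gamma>2 * ((norm d)\<^sup>2 + (norm (x' - y'))\<^sup>2))"
  proof -
    have "d \<bullet> (f y x' - f y y') \<le> norm d * (\<gamma>2 * norm (x' - y'))"
      using norm_cauchy_schwarz[of d "f y x' - f y y'"] mult_left_mono[OF lip[of y x' y'] norm_ge_zero[of d]]
      by linarith
    also have "2 * \<dots> \<le> \<gamma>2 * ((norm d)\<^sup>2 + (norm (x' - y'))\<^sup>2)"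
      using mult_left_mono[OF sum_squares_bound[of "norm d" "norm (x' - y')"] \<open>0 \<le> \<gamma>2\<close>]
      by (simp add: mult_ac)
    finally show ?thesis using \<open>h > 0\<close> by simp
  qed
  moreover have "d \<bullet> d = (norm d)\<^sup>2"
    by (simp add: power2_norm_eq_inner)
  ultimately have "2 * (norm d)\<^sup>2 \<le> (norm d)\<^sup>2 + (norm (u - v))\<^sup>2 + 2 * (h * (\<gamma>1 * (norm d)\<^sup>2))
      + h * (\<gamma>2 * ((norm d)\<^sup>2 + (norm (x' - y'))\<^sup>2))"
    by linarith
  then show ?thesis
    unfolding d_def[symmetric] by (simp add: algebra_simps)
qed

text \<open>The defect of the inequality is exactly \<open>\<mu> * (1 - \<mu>)\<close> times the
  squared distance of the two points.\<close>

lemma norm_sq_convex: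
  fixes x y :: "'a::real_inner"
  assumes "0 \<le> \<mu>" "\<mu> \<le> 1"
  shows "(norm (\<mu> *\<^sub>R x + (1 - \<mu>) *\<^sub>R y))\<^sup>2 \<le> \<mu> * (norm x)\<^sup>2 + (1 - \<mu>) * (norm y)\<^sup>2"
proof -
  have "\<mu> * (norm x)\<^sup>2 + (1 - \<mu>) * (norm y)\<^sup>2 - (norm (\<mu> *\<^sub>R x + (1 - \<mu>) *\<^sub>R y))\<^sup>2
     = \<mu> * (1 - \<mu>) * (norm (x - y))\<^sup>2"
    unfolding power2_norm_eq_inner inner_add_left inner_add_right inner_diff_left inner_diff_right
      inner_scaleR_left inner_scaleR_right inner_commute[of y x]
    by (simp only: algebra_simps)
  moreover have "0 \<le> \<mu> * (1 - \<mu>) * (norm (x - y))\<^sup>2" using assms by simp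
  ultimately show ?thesis by linarith
qed

text \<open>Serves to make \<open>g\<close> jointly Borel, so that the diffusion coefficient at
  adapted stage values is adapted. The squared increment is squeezed between zero and a bound that
  tends to zero.\<close>

lemma continuous_of_sq_lipschitz:
  fixes g :: "'a::real_normed_vector \<Rightarrow> 'b::real_normed_vector \<Rightarrow> 'c::real_normed_vector"
  assumes "\<And>x1 x2 y1 y2. (norm (g x2 y2 - g x1 y1))\<^sup>2 \<le> c * (norm (x2 - x1))\<^sup>2 + d * (norm (y2 - y1))\<^sup>2"
  shows "continuous_on UNIV (\<lambda>p. g (fst p) (snd p))"
proof (rule continuous_at_imp_continuous_on, rule ballI)
  fix p :: "'a \<times> 'b"
  have "((\<lambda>q. c * (norm (fst q - fst p))\<^sup>2 + d * (norm (snd q - snd p))\<^sup>2) \<longlongrightarrow>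
      c * (norm (fst p - fst p))\<^sup>2 + d * (norm (snd p - snd p))\<^sup>2) (at p)"
    by (intro tendsto_intros)
  then have *: "((\<lambda>q. c * (norm (fst q - fst p))\<^sup>2 + d * (norm (snd q - snd p))\<^sup>2) \<longlongrightarrow> 0) (at p)"
    by simp
  have "((\<lambda>q. (norm (g (fst q) (snd q) - g (fst p) (snd p)))\<^sup>2) \<longlongrightarrow> 0) (at p)"
    by (rule tendsto_sandwich[OF _ _ tendsto_const *]; rule always_eventually; rule allI)
      (rule zero_le_power2 assms)+
  then have "((\<lambda>q. sqrt ((norm (g (fst q) (snd q) - g (fst p) (snd p)))\<^sup>2)) \<longlongrightarrow> sqrt 0) (at p)"
    by (rule tendsto_real_sqrt)
  then show "isCont (\<lambda>p. g (fst p) (snd p)) p"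
    unfolding isCont_def by (simp add: LIM_zero_cancel tendsto_norm_zero_iff)
qed

section \<open>Moments of a Wiener increment\<close>

lemma wiener_increment_moments:
  fixes w :: "real \<Rightarrow> 'a \<Rightarrow> real^'m"
  assumes M: "prob_space M" and W: "wiener_process M F w" and s: "0 \<le> s" "s < t"
  shows "integrable M (\<lambda>\<omega>. (w t \<omega> - w s \<omega>) $ i)"
    and "integrable M (\<lambda>\<omega>. (w t \<omega> - w s \<omega>) $ i * (w t \<omega> - w s \<omega>) $ j)"
    and "integral\<^sup>L M (\<lambda>\<omega>. (w t \<omega> - w s \<omega>) $ i) = 0"
    and "integral\<^sup>L M (\<lambda>\<omega>. (w t \<omega> - w s \<omega>) $ i * (w t \<omega> - w s \<omega>) $ j) = (if i = j then t - s else 0)"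
proof -
  interpret prob_space M by fact
  define Z where "Z = (\<lambda>i \<omega>. (w t \<omega> - w s \<omega>) $ i)"
  have D: "distributed M lborel (Z i) (\<lambda>x. ennreal (normal_density 0 (sqrt (t - s)) x))" for i
    using W s unfolding wiener_process_def Z_def by blast
  have ind: "indep_vars (\<lambda>_. borel) Z UNIV"
    using W s unfolding wiener_process_def Z_def by blast
  have pos: "0 < sqrt (t - s)" using s by simp
  have int1: "integrable M (Z i)" for i
    using distributed_integrable[OF D[of i], of "\<lambda>x. x"] integrable_normal_moment[OF pos, of 0 1] by simp
  have int2: "integrable M (\<lambda>\<omega>. (Z i \<omega>)\<^sup>2)" for i
    using distributed_integrable[OF D[of i], of "\<lambda>x. x\<^sup>2"] integrable_normal_moment[OF pos, of 0 2] by simp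
  have mean: "expectation (Z i) = 0" for i
    by (rule normal_distributed_expectation[OF pos D])
  have var: "expectation (\<lambda>\<omega>. (Z i \<omega>)\<^sup>2) = t - s" for i
    using normal_distributed_variance[OF pos D[of i]] mean[of i] s by simp
  have ind2: "indep_var borel (Z i) borel (Z j)" if "i \<noteq> j" for i j
    \<comment> \<open>The sum over the singleton \<open>{j}\<close> is \<open>Z j\<close>, which
      turns independence of the family into independence of a pair.\<close>
    using indep_vars_sum[of "{j}" i Z] indep_vars_subset[OF ind, of "{i, j}"] that by simp
  have meas: "Z i \<in> borel_measurable M" for i using int1[of i] by auto
  show "integrable M (\<lambda>\<omega>. (w t \<omega> - w s \<omega>) $ i)"
    using int1[of i] by (simp add: Z_def)
  show "integrable M (\<lambda>\<omega>. (w t \<omega> - w s \<omega>) $ i * (w t \<omega> - w s \<omega>) $ j)"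
    using integrable_mult_of_squares[OF meas meas int2 int2, of i j] by (simp add: Z_def)
  show "expectation (\<lambda>\<omega>. (w t \<omega> - w s \<omega>) $ i) = 0"
    using mean[of i] by (simp add: Z_def)
  show "expectation (\<lambda>\<omega>. (w t \<omega> - w s \<omega>) $ i * (w t \<omega> - w s \<omega>) $ j) = (if i = j then t - s else 0)"
    using var[of i] indep_var_lebesgue_integral[OF ind2 int1 int1, of i j] mean
    by (auto simp: Z_def power2_eq_square)
qed

section \<open>The scalar delayed recursion and its rate\<close>

lemma ennreal_le_divide_of_mult_le:
  assumes "ennreal x * u \<le> ennreal y" "0 < x"
  shows "u \<le> ennreal (y / x)"
proof -
  have "u = ennreal (1 / x) * (ennreal x * u)"
    using \<open>0 < x\<close> by (simp add: mult.assoc[symmetric] ennreal_mult[symmetric])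
  also have "\<dots> \<le> ennreal (1 / x) * ennreal y"
    using assms(1) by (rule mult_left_mono) simp
  also have "\<dots> = ennreal (y / x)"
    using \<open>0 < x\<close> by (simp add: ennreal_mult'[symmetric])
  finally show ?thesis .
qed

lemma ennreal_lincomb_le:
  assumes "u \<le> ennreal x" "v \<le> ennreal y" "0 \<le> a" "0 \<le> b" "0 \<le> x" "0 \<le> y"
  shows "ennreal a * u + ennreal b * v \<le> ennreal (a * x + b * y)"
proof -
  have "ennreal a * u + ennreal b * v \<le> ennreal a * ennreal x + ennreal b * ennreal y"
    using assms by (intro add_mono mult_left_mono) auto
  then show ?thesis using assms by (simp add: ennreal_mult ennreal_plus)
qed

text \<open>Removes the weight of the implicit unknown from the contraction factor: lowering
  numerator and denominator of a fraction below one by the same amount can only decrease it.\<close>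

lemma ratio_le_of_shift:
  fixes a b x :: real
  assumes "0 < b" "b < a" "0 \<le> x" "x < a"
  shows "(b - x) / (a - x) \<le> b / a"
proof -
  have "b * x \<le> a * x" using assms by (intro mult_right_mono) auto
  then show ?thesis using assms by (simp add: field_simps)
qed

text \<open>Here \<open>u\<close>, \<open>v\<close>, \<open>p\<close> stand for the mean squares of
  the stage, solution and delayed differences; \<open>\<theta> n\<close> is the weight of the
  current stage in the delayed value and \<open>r\<close> the contribution of the past. In
  \<open>stage\<close> the current share has already been moved to the left. The assumption
  \<open>window\<close> says that \<open>r n\<close> is at most the maximum over the last
  \<open>\<kappa>\<close> stages and, for \<open>n < \<kappa>\<close>, the initial bound
  \<open>N\<close>. Strong induction compares with a staircase that drops by the factor
  \<open>\<rho>\<close> every \<open>\<kappa> + 1\<close> steps, and yields finiteness along the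
  way.\<close>

lemma delayed_recursion_decay:
  fixes u v r p :: "nat \<Rightarrow> ennreal" and \<theta> :: "nat \<Rightarrow> real" and a c2 c3 c4 N :: real and \<kappa> :: nat
  assumes nonneg: "0 \<le> c2" "0 \<le> c3" "0 \<le> c4" "0 \<le> N" and gap: "1 + c2 + c3 + c4 < a"
    and \<theta>: "\<And>n. 0 \<le> \<theta> n" "\<And>n. \<theta> n \<le> 1"
    and stage: "\<And>n. ennreal (a - c2 * \<theta> n) * u n \<le> v n + ennreal (c2 * (1 - \<theta> n)) * r n"
    and step: "\<And>n. v (Suc n) \<le> ennreal (1 + c3) * u n + ennreal c4 * p n"
    and p: "\<And>n. p n \<le> ennreal (\<theta> n) * u n + ennreal (1 - \<theta> n) * r n"
    and init: "v 0 \<le> ennreal N"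
    and window: "\<And>n C. (\<And>k. k < n \<Longrightarrow> n \<le> k + \<kappa> \<Longrightarrow> u k \<le> C) \<Longrightarrow> (n < \<kappa> \<Longrightarrow> ennreal N \<le> C) \<Longrightarrow> r n \<le> C"
  shows "v n \<le> ennreal ((1 + c3 + c4) * ((1 + c2 + c3 + c4) / a) ^ (n div (\<kappa> + 1)) * N)"
proof -
  define \<rho> where "\<rho> = (1 + c2 + c3 + c4) / a"
  define C where "C n = \<rho> ^ (n div (\<kappa> + 1)) * N" for n
  have \<rho>: "0 < \<rho>" "\<rho> < 1" using nonneg gap by (auto simp: \<rho>_def)
  have C0: "0 \<le> C n" for n using \<rho> nonneg by (simp add: C_def)
  have C_early: "C n = N" if "n < \<kappa> + 1" for n using that by (simp add: C_def)
  \<comment> \<open>Going \<open>\<kappa> + 1\<close> indices forward enters the next block exactly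
    once, so one factor \<open>\<rho>\<close> pays for the whole window.\<close>
  have C_window: "\<rho> * C k \<le> C n" if "n \<le> k + (\<kappa> + 1)" for k n
  proof -
    have "n div (\<kappa> + 1) \<le> (k + (\<kappa> + 1)) div (\<kappa> + 1)" using that by (rule div_le_mono)
    also have "\<dots> = Suc (k div (\<kappa> + 1))"
      using div_add_self2[of "\<kappa> + 1" k] by simp
    finally have "\<rho> ^ Suc (k div (\<kappa> + 1)) \<le> \<rho> ^ (n div (\<kappa> + 1))"
      using \<rho> by (intro power_decreasing) auto
    from mult_right_mono[OF this nonneg(4)] show ?thesis by (simp add: C_def mult_ac)
  qed
  \<comment> \<open>The extra \<open>\<rho>\<close> in the bound for \<open>u\<close> is what lets
    \<open>C_window\<close> turn bounds at earlier indices into the bound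
    \<open>C n\<close>.\<close>
  have *: "u n \<le> ennreal (\<rho> * C n) \<and> v n \<le> ennreal ((1 + c3 + c4) * C n)" for n
  proof (induction n rule: less_induct)
    case (less n)
    have u: "u k \<le> ennreal (C n)" if "k < n" "n \<le> k + (\<kappa> + 1)" for k
      using less[OF that(1)] C_window[OF that(2)] by (meson ennreal_leI order_trans)
    \<comment> \<open>This is needed for \<open>m = n\<close> in the stage inequality and for
      \<open>m = n - 1\<close> in the step to \<open>v n\<close>. In the latter case the window
      reaches back to \<open>n - 1 - \<kappa>\<close>, whence blocks of length
      \<open>\<kappa> + 1\<close>. If initial values enter, then
      \<open>n \<le> Suc m < \<kappa> + 1\<close> and \<open>C n\<close> is still
      \<open>N\<close>.\<close>
    have r: "r m \<le> ennreal (C n)" if "m \<le> n" "n \<le> Suc m" for m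
      using that by (intro window u) (auto simp: C_early)
    have v: "v n \<le> ennreal ((1 + c3 + c4) * C n)"
    proof (cases n)
      case 0
      have "N \<le> (1 + c3 + c4) * N" using nonneg mult_right_mono[of 1 "1 + c3 + c4" N] by simp
      then show ?thesis using init 0 by (simp add: C_def) (meson ennreal_leI order_trans)
    next
      case (Suc m)
      have um: "u m \<le> ennreal (C n)" using Suc by (intro u) auto
      have "p m \<le> ennreal (\<theta> m * C n + (1 - \<theta> m) * C n)"
        by (rule order_trans[OF p ennreal_lincomb_le]) (use um r[of m] Suc \<theta> C0 in auto)
      then have pm: "p m \<le> ennreal (C n)" by (simp add: algebra_simps)
      have "v n \<le> ennreal ((1 + c3) * C n + c4 * C n)"
        unfolding Suc by (rule order_trans[OF step ennreal_lincomb_le]) (use um pm Suc nonneg C0 in auto)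
      then show ?thesis by (simp add: algebra_simps)
    qed
    have x: "0 \<le> c2 * \<theta> n" "c2 * \<theta> n \<le> c2"
      using nonneg \<theta> mult_left_mono[of "\<theta> n" 1 c2] by auto
    have "ennreal (a - c2 * \<theta> n) * u n \<le> ennreal 1 * v n + ennreal (c2 * (1 - \<theta> n)) * r n"
      using stage[of n] by simp
    also have "\<dots> \<le> ennreal (1 * ((1 + c3 + c4) * C n) + c2 * (1 - \<theta> n) * C n)"
      by (rule ennreal_lincomb_le) (use v r[of n] nonneg \<theta> C0 in auto)
    finally have "u n \<le> ennreal ((1 * ((1 + c3 + c4) * C n) + c2 * (1 - \<theta> n) * C n) / (a - c2 * \<theta> n))"
      by (rule ennreal_le_divide_of_mult_le) (use x gap nonneg in linarith)
    \<comment> \<open>Numerator and denominator are \<open>1 + c2 + c3 + c4\<close> and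
      \<open>a\<close>, both lowered by \<open>c2 * \<theta> n\<close>.\<close>
    also have "(1 * ((1 + c3 + c4) * C n) + c2 * (1 - \<theta> n) * C n) / (a - c2 * \<theta> n)
        = ((1 + c2 + c3 + c4) - c2 * \<theta> n) / (a - c2 * \<theta> n) * C n"
      by (simp add: algebra_simps)
    also have "\<dots> \<le> \<rho> * C n"
      unfolding \<rho>_def using x gap nonneg C0 by (intro mult_right_mono ratio_le_of_shift) linarith+
    finally show ?case using v by (simp add: ennreal_leI)
  qed
  show ?thesis using * [of n] by (simp add: C_def \<rho>_def mult.assoc)
qed

text \<open>With \<open>s = ln (a / b)\<close> the power is at most
  \<open>exp (s - s * n / (\<kappa> + 1))\<close>, the summand \<open>s\<close> paying for the
  rounding in \<open>div\<close>. The target uses half of this exponent; the other half eventually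
  exceeds \<open>ln c + s\<close>.\<close>

lemma eventually_power_div_le_exp:
  fixes a b c h :: real and \<kappa> :: nat
  assumes "0 < b" "b < a" "0 < c" "0 < h"
  shows "\<forall>\<^sub>F n in sequentially.
    c * (b / a) ^ (n div (\<kappa> + 1)) \<le> exp (- (1 / (2 * (real \<kappa> + 1) * h) * ln (a / b)) * real n * h)"
proof -
  define s where "s = ln (a / b)"
  have s: "0 < s" using assms by (simp add: s_def)
  have ba: "b / a = exp (- s)" using assms by (simp add: s_def exp_minus)
  \<comment> \<open>The threshold solves \<open>s * n / (2 * (\<kappa> + 1)) = ln c + s\<close> for
    \<open>n\<close>.\<close>
  obtain n0 where n0: "2 * (real \<kappa> + 1) * (ln c + s) / s \<le> real n0"
    using real_arch_simple by blast
  show ?thesis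
  proof (rule eventually_sequentiallyI[of n0])
    fix n assume "n0 \<le> n"
    have "2 * (real \<kappa> + 1) * (ln c + s) / s \<le> real n" using n0 \<open>n0 \<le> n\<close> by linarith
    then have n: "ln c + s \<le> s * (real n / (2 * (real \<kappa> + 1)))"
      using s by (simp add: field_simps)
    have "real n / real (\<kappa> + 1) \<le> real (n div (\<kappa> + 1)) + 1"
    proof -
      have "n \<le> (n div (\<kappa> + 1) + 1) * (\<kappa> + 1)"
        using dividend_less_div_times[of "\<kappa> + 1" n] by simp
      then have "real n \<le> (real (n div (\<kappa> + 1)) + 1) * real (\<kappa> + 1)"
        by (metis of_nat_1 of_nat_add of_nat_le_iff of_nat_mult)
      then show ?thesis by (simp add: divide_le_eq)
    qed
    from mult_left_mono[OF this less_imp_le[OF s]]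
    have k: "s * (real n / (real \<kappa> + 1)) \<le> s * real (n div (\<kappa> + 1)) + s"
      by (simp add: algebra_simps)
    have "c * (b / a) ^ (n div (\<kappa> + 1)) = exp (ln c - s * real (n div (\<kappa> + 1)))"
      using \<open>0 < c\<close> unfolding ba by (simp add: exp_diff exp_minus exp_of_nat_mult[symmetric] field_simps)
    also have "\<dots> \<le> exp (- (s * (real n / (2 * (real \<kappa> + 1)))))"
    proof -
      have "s * (real n / (real \<kappa> + 1)) = 2 * (s * (real n / (2 * (real \<kappa> + 1))))"
        by (simp add: divide_simps)
      then show ?thesis using n k by simp
    qed
    also have "- (s * (real n / (2 * (real \<kappa> + 1)))) = - (1 / (2 * (real \<kappa> + 1) * h) * ln (a / b)) * real n * h"
      using \<open>0 < h\<close> by (simp add: s_def)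
    finally show "c * (b / a) ^ (n div (\<kappa> + 1)) \<le> exp (- (1 / (2 * (real \<kappa> + 1) * h) * ln (a / b)) * real n * h)" .
  qed
qed

section \<open>Initial paths and the delayed stage value\<close>

text \<open>Continuity on a compact interval bounds the set under the real supremum; for an
  unbounded set that supremum would carry no information.\<close>

lemma norm_le_path_norm:
  assumes "continuous_on {-\<tau>..0} u" "s \<in> {-\<tau>..0}"
  shows "norm (u s) \<le> path_norm \<tau> u"
proof -
  have "compact ((\<lambda>s. norm (u s)) ` {-\<tau>..0})"
    by (intro compact_continuous_image continuous_on_norm assms(1) compact_Icc)
  then show ?thesis
    unfolding path_norm_def
    by (intro cSUP_upper assms(2)) (simp add: compact_imp_bounded bounded_imp_bdd_above)
qed

lemma usual_filtration_subalgebra: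
  assumes "usual_filtration M F" "0 \<le> s"
  shows "subalgebra M (F s)" and "s \<le> t \<Longrightarrow> subalgebra (F t) (F s)"
proof -
  have *: "subalgebra M (F r)" if "0 \<le> r" for r
    using assms(1) that unfolding usual_filtration_def by blast
  show "subalgebra M (F s)" by (rule *[OF assms(2)])
  show "subalgebra (F t) (F s)" if "s \<le> t"
  proof -
    have "sets (F s) \<subseteq> sets (F t)"
      using assms that unfolding usual_filtration_def by blast
    then show ?thesis
      using *[of s] *[of t] assms(2) that by (auto simp: subalgebra_def)
  qed
qed

text \<open>Needed so that the diffusion coefficient at step \<open>n\<close> is independent of the
  Wiener increment that follows.\<close>

lemma ssbe_delayed_adapted:
  fixes \<psi> :: "real \<Rightarrow> 'a \<Rightarrow> real^'d" and ys :: "nat \<Rightarrow> 'a \<Rightarrow> real^'d"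
  assumes F: "usual_filtration M F" and "0 < h" and dl: "\<And>t. t \<ge> 0 \<Longrightarrow> 0 \<le> dl t \<and> dl t \<le> \<tau>"
    and ip: "interpolation h dl q \<mu>" and \<psi>: "\<And>t. t \<in> {-\<tau>..0} \<Longrightarrow> \<psi> t \<in> borel_measurable (F 0)"
    and ys: "\<And>k. ys k \<in> borel_measurable (F (grid h k))"
  shows "ssbe_delayed h dl q \<mu> \<psi> ys n \<in> borel_measurable (F (grid h n))"
proof -
  have mono: "X \<in> borel_measurable (F t)" if "X \<in> borel_measurable (F s)" "0 \<le> s" "s \<le> t"
    for X :: "'a \<Rightarrow> real^'d" and s t
  proof -
    from measurable_from_subalg[OF usual_filtration_subalgebra(2)[OF F that(2,3)] that(1)]
    show ?thesis .
  qed
  have grid: "0 \<le> grid h k" "k \<le> n \<Longrightarrow> grid h k \<le> grid h n" for k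
    using \<open>0 < h\<close> by (auto simp: grid_def)
  consider "grid h n - dl (grid h n) < 0" | "0 \<le> grid h n - dl (grid h n)" "dl (grid h n) = 0"
    | "0 \<le> grid h n - dl (grid h n)" "dl (grid h n) \<noteq> 0" by linarith
  then show ?thesis
  proof cases
    case 1
    then have "grid h n - dl (grid h n) \<in> {-\<tau>..0}" using dl[OF grid(1)[of n]] grid(1)[of n] by auto
    from mono[OF \<psi>[OF this] _ grid(1)] 1 show ?thesis by (simp add: ssbe_delayed_def cong: measurable_cong)
  next
    case 2
    then show ?thesis using ys[of n] by (simp add: ssbe_delayed_def cong: measurable_cong)
  next
    case 3
    \<comment> \<open>These bounds give \<open>n - q n + 1 \<le> n\<close> without truncated
      subtraction, so both interpolation nodes are known at the current grid time.\<close>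
    then have "1 \<le> q n" "q n \<le> n" using ip by (auto simp: interpolation_def)
    then have [measurable]: "ys (n - q n + 1) \<in> borel_measurable (F (grid h n))"
      "ys (n - q n) \<in> borel_measurable (F (grid h n))"
      by (intro mono[OF ys grid(1) grid(2)]; simp)+
    have "(\<lambda>\<omega>. \<mu> n *\<^sub>R ys (n - q n + 1) \<omega> + (1 - \<mu> n) *\<^sub>R ys (n - q n) \<omega>)
        \<in> borel_measurable (F (grid h n))" by measurable
    then show ?thesis using 3 by (simp add: ssbe_delayed_def cong: measurable_cong)
  qed
qed

text \<open>Separates the share \<open>\<theta>\<close> of the implicit current stage from a
  remainder \<open>R\<close> that depends on the past. The witnesses are \<open>\<theta> = 0\<close>
  with \<open>R = E\<close> for initial values and for \<open>q n \<ge> 2\<close>,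
  \<open>\<theta> = 1\<close> with \<open>R = 0\<close> for zero delay, and
  \<open>\<theta> = \<mu> n\<close> with the previous stage for \<open>q n = 1\<close>. Quantifying
  over all bounds \<open>C\<close> expresses a maximum over a window that may be empty.\<close>

lemma delayed_error_split:
  fixes Xs Ys :: "nat \<Rightarrow> 'a \<Rightarrow> real^'d" and \<psi> \<phi> :: "real \<Rightarrow> 'a \<Rightarrow> real^'d"
  assumes "0 < h" and "\<kappa> \<ge> 1" and "0 \<le> \<delta>" and \<tau>: "\<tau> = (real \<kappa> - \<delta>) * h"
    and dl: "\<And>t. t \<ge> 0 \<Longrightarrow> 0 \<le> dl t \<and> dl t \<le> \<tau>"
    and ip: "interpolation h dl q \<mu>"
    and \<psi>: "\<And>\<omega>. \<omega> \<in> space M \<Longrightarrow> continuous_on {-\<tau>..0} (\<lambda>t. \<psi> t \<omega>)"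
    and \<phi>: "\<And>\<omega>. \<omega> \<in> space M \<Longrightarrow> continuous_on {-\<tau>..0} (\<lambda>t. \<phi> t \<omega>)"
    and [measurable]: "\<And>k. Xs k \<in> borel_measurable M" "\<And>k. Ys k \<in> borel_measurable M"
    and E: "E = (\<lambda>\<omega>. (norm (ssbe_delayed h dl q \<mu> \<psi> Xs n \<omega> - ssbe_delayed h dl q \<mu> \<phi> Ys n \<omega>))\<^sup>2)"
    and E_meas [measurable]: "E \<in> borel_measurable M"
  shows "\<exists>\<theta> R. 0 \<le> \<theta> \<and> \<theta> \<le> 1 \<and> R \<in> borel_measurable M \<and> (\<forall>\<omega>. 0 \<le> R \<omega>) \<and>
    (\<forall>\<omega>. E \<omega> \<le> \<theta> * (norm (Xs n \<omega> - Ys n \<omega>))\<^sup>2 + (1 - \<theta>) * R \<omega>) \<and>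
    (\<forall>C. (\<forall>k. k < n \<longrightarrow> n \<le> k + \<kappa> \<longrightarrow> (\<integral>\<^sup>+\<omega>. ennreal ((norm (Xs k \<omega> - Ys k \<omega>))\<^sup>2) \<partial>M) \<le> C) \<longrightarrow>
      (n < \<kappa> \<longrightarrow> mean_sq M (\<lambda>\<omega>. path_norm \<tau> (\<lambda>s. \<phi> s \<omega> - \<psi> s \<omega>)) \<le> C) \<longrightarrow>
      (\<integral>\<^sup>+\<omega>. ennreal (R \<omega>) \<partial>M) \<le> C)"
proof -
  define t where "t = grid h n"
  have t0: "0 \<le> t" using \<open>0 < h\<close> by (simp add: t_def grid_def)
  have E0: "0 \<le> E \<omega>" for \<omega> by (simp add: E)
  have \<tau>_le: "\<tau> \<le> real \<kappa> * h" using \<open>0 \<le> \<delta>\<close> \<open>0 < h\<close> by (simp add: \<tau> algebra_simps)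
  consider "t - dl t < 0" | "0 \<le> t - dl t" "dl t = 0" | "0 \<le> t - dl t" "dl t \<noteq> 0" by linarith
  then show ?thesis
  proof cases
    case 1
    then have mem: "t - dl t \<in> {-\<tau>..0}" using dl[OF t0] t0 by auto
    \<comment> \<open>An initial value enters only while
      \<open>n * h < dl t \<le> \<tau> \<le> \<kappa> * h\<close>.\<close>
    have "real n * h < real \<kappa> * h" using 1 dl[OF t0] \<tau>_le by (simp add: t_def grid_def)
    then have "n < \<kappa>" using \<open>0 < h\<close> by simp
    have "(\<integral>\<^sup>+\<omega>. ennreal (E \<omega>) \<partial>M) \<le> mean_sq M (\<lambda>\<omega>. path_norm \<tau> (\<lambda>s. \<phi> s \<omega> - \<psi> s \<omega>))"
      unfolding mean_sq_def
    proof (intro nn_integral_mono ennreal_leI)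
      fix \<omega> assume "\<omega> \<in> space M"
      from norm_le_path_norm[OF continuous_on_diff[OF \<phi>[OF this] \<psi>[OF this]] mem]
      show "E \<omega> \<le> (path_norm \<tau> (\<lambda>s. \<phi> s \<omega> - \<psi> s \<omega>))\<^sup>2"
        using 1 by (simp add: E ssbe_delayed_def t_def[symmetric] norm_minus_commute power_mono)
    qed
    then show ?thesis
      using E0 E_meas \<open>n < \<kappa>\<close> by (intro exI[of _ 0] exI[of _ E]) auto
  next
    case 2
    then have "E \<omega> = (norm (Xs n \<omega> - Ys n \<omega>))\<^sup>2" for \<omega>
      by (simp add: E ssbe_delayed_def t_def[symmetric])
    then show ?thesis by (intro exI[of _ 1] exI[of _ "\<lambda>_. 0"]) auto
  next
    case 3
    then have q: "1 \<le> q n" "q n \<le> n" and "t - dl t < grid h (n - q n + 1)"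
      using ip by (auto simp: interpolation_def t_def)
    \<comment> \<open>The retarded time lies strictly before the right node, so the delay exceeds
      \<open>(q n - 1) * h\<close>. With \<open>\<tau> \<le> \<kappa> * h\<close> this gives
      \<open>q n \<le> \<kappa>\<close>, and the older node stays in the window.\<close>
    then have "(real (q n) - 1) * h < dl t"
      using of_nat_diff[OF q(2), where 'a = real] by (simp add: t_def grid_def algebra_simps)
    then have "(real (q n) - 1) * h < real \<kappa> * h" using dl[OF t0] \<tau>_le by linarith
    then have q\<kappa>: "q n \<le> \<kappa>" using \<open>0 < h\<close> by simp
    have \<mu>: "0 \<le> \<mu> n" "\<mu> n \<le> 1" using ip by (auto simp: interpolation_def less_imp_le)
    have split: "E \<omega> \<le> \<mu> n * (norm (Xs (n - q n + 1) \<omega> - Ys (n - q n + 1) \<omega>))\<^sup>2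
        + (1 - \<mu> n) * (norm (Xs (n - q n) \<omega> - Ys (n - q n) \<omega>))\<^sup>2" for \<omega>
    proof -
      have "E \<omega> = (norm (\<mu> n *\<^sub>R (Xs (n - q n + 1) \<omega> - Ys (n - q n + 1) \<omega>)
          + (1 - \<mu> n) *\<^sub>R (Xs (n - q n) \<omega> - Ys (n - q n) \<omega>)))\<^sup>2"
        using 3 by (simp add: E ssbe_delayed_def t_def[symmetric] algebra_simps)
      then show ?thesis using norm_sq_convex[OF \<mu>] by simp
    qed
    show ?thesis
    proof (cases "q n = 1")
      case True
      \<comment> \<open>The newer node is the implicit unknown itself; the older one is the previous
        stage, in the window since \<open>\<kappa> \<ge> 1\<close>.\<close>
      then have "n - q n + 1 = n" using q by simp
      then show ?thesis using split \<mu> q q\<kappa> \<open>\<kappa> \<ge> 1\<close>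
        by (intro exI[of _ "\<mu> n"] exI[of _ "\<lambda>\<omega>. (norm (Xs (n - q n) \<omega> - Ys (n - q n) \<omega>))\<^sup>2"]) auto
    next
      case False
      \<comment> \<open>Now \<open>q n \<ge> 2\<close>: both nodes lie strictly in the past, and a
        convex combination of bounds \<open>C\<close> is \<open>C\<close>.\<close>
      have "(\<integral>\<^sup>+\<omega>. ennreal (E \<omega>) \<partial>M) \<le> C"
        if C: "\<forall>k. k < n \<longrightarrow> n \<le> k + \<kappa> \<longrightarrow> (\<integral>\<^sup>+\<omega>. ennreal ((norm (Xs k \<omega> - Ys k \<omega>))\<^sup>2) \<partial>M) \<le> C" for C
      proof -
        have "(\<integral>\<^sup>+\<omega>. ennreal (E \<omega>) \<partial>M)
          \<le> (\<integral>\<^sup>+\<omega>. ennreal (\<mu> n) * ennreal ((norm (Xs (n - q n + 1) \<omega> - Ys (n - q n + 1) \<omega>))\<^sup>2)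
            + ennreal (1 - \<mu> n) * ennreal ((norm (Xs (n - q n) \<omega> - Ys (n - q n) \<omega>))\<^sup>2) \<partial>M)"
          using split \<mu> by (intro nn_integral_mono)
            (simp add: ennreal_mult[symmetric] ennreal_plus[symmetric] del: ennreal_plus)
        also have "\<dots> = ennreal (\<mu> n) * (\<integral>\<^sup>+\<omega>. ennreal ((norm (Xs (n - q n + 1) \<omega> - Ys (n - q n + 1) \<omega>))\<^sup>2) \<partial>M)
            + ennreal (1 - \<mu> n) * (\<integral>\<^sup>+\<omega>. ennreal ((norm (Xs (n - q n) \<omega> - Ys (n - q n) \<omega>))\<^sup>2) \<partial>M)"
          by (simp add: nn_integral_add nn_integral_cmult)
        also have "\<dots> \<le> ennreal (\<mu> n) * C + ennreal (1 - \<mu> n) * C"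
          using C False q q\<kappa> by (intro add_mono mult_left_mono) auto
        also have "\<dots> = C"
          using \<mu> by (simp add: distrib_right[symmetric] ennreal_plus[symmetric] del: ennreal_plus)
        finally show ?thesis .
      qed
      then show ?thesis
        using E0 E_meas by (intro exI[of _ 0] exI[of _ E]) auto
    qed
  qed
qed

section \<open>Mean-square decay of the scheme\<close>

text \<open>Instantiates \<open>delayed_recursion_decay\<close> with \<open>h * \<gamma>2\<close>,
  \<open>h * \<gamma>3\<close>, \<open>h * \<gamma>4\<close>: the implicit stage gives
  \<open>stage\<close>, the one-step isometry gives \<open>step\<close>, and
  \<open>delayed_error_split\<close> gives the weights and the window.\<close>

lemma ssbe_mean_sq_decay:
  fixes M :: "'a measure" and w :: "real \<Rightarrow> 'a \<Rightarrow> real^'m"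
    and f :: "real^'d \<Rightarrow> real^'d \<Rightarrow> real^'d"
    and g :: "real^'d \<Rightarrow> real^'d \<Rightarrow> real^'m^'d"
    and \<gamma>1 \<gamma>2 \<gamma>3 \<gamma>4 \<tau> h \<delta> N :: real and \<kappa> :: nat
  assumes M: "prob_space M" and F: "usual_filtration M F" and W: "wiener_process M F w"
    and one_sided: "\<And>x1 x2 y. (x2 - x1) \<bullet> (f x2 y - f x1 y) \<le> \<gamma>1 * (norm (x2 - x1))\<^sup>2"
    and lip_f: "\<And>x y1 y2. norm (f x y2 - f x y1) \<le> \<gamma>2 * norm (y2 - y1)"
    and lip_g: "\<And>x1 x2 y1 y2. (norm (g x2 y2 - g x1 y1))\<^sup>2
           \<le> \<gamma>3 * (norm (x2 - x1))\<^sup>2 + \<gamma>4 * (norm (y2 - y1))\<^sup>2"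
    and nonneg: "0 \<le> \<gamma>2" "0 \<le> \<gamma>3" "0 \<le> \<gamma>4"
    and dl: "\<And>t. t \<ge> 0 \<Longrightarrow> 0 \<le> dl t \<and> dl t \<le> \<tau>"
    and \<beta>: "2 * \<gamma>1 + 2 * \<gamma>2 + \<gamma>3 + \<gamma>4 < 0"
    and h: "h > 0" and \<tau>: "0 < \<tau>" and \<kappa>: "\<kappa> \<ge> 1" "0 \<le> \<delta>" "\<tau> = (real \<kappa> - \<delta>) * h"
    and ip: "interpolation h dl q \<mu>"
    and \<psi>: "initial_datum M F w \<tau> \<psi>" and \<phi>: "initial_datum M F w \<tau> \<phi>"
    and X: "ssbe_solution M F f g w h dl q \<mu> \<psi> X Xs"
    and Y: "ssbe_solution M F f g w h dl q \<mu> \<phi> Y Ys"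
    and N: "mean_sq M (\<lambda>\<omega>. path_norm \<tau> (\<lambda>s. \<phi> s \<omega> - \<psi> s \<omega>)) = ennreal N" "0 \<le> N"
  shows "mean_sq M (\<lambda>\<omega>. norm (X n \<omega> - Y n \<omega>))
    \<le> ennreal ((1 + h * \<gamma>3 + h * \<gamma>4)
        * ((1 + h * \<gamma>2 + h * \<gamma>3 + h * \<gamma>4) / (1 - 2 * h * \<gamma>1 - h * \<gamma>2)) ^ (n div (\<kappa> + 1)) * N)"
proof -
  interpret prob_space M by fact
  define DX where "DX = ssbe_delayed h dl q \<mu> \<psi> Xs"
  define DY where "DY = ssbe_delayed h dl q \<mu> \<phi> Ys"
  define E where "E n \<omega> = (norm (DX n \<omega> - DY n \<omega>))\<^sup>2" for n \<omega>
  define S where "S n \<omega> = (norm (Xs n \<omega> - Ys n \<omega>))\<^sup>2" for n \<omega>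
  define V where "V n \<omega> = (norm (X n \<omega> - Y n \<omega>))\<^sup>2" for n \<omega>
  have grid0: "0 \<le> grid h k" for k using h by (simp add: grid_def)
  note sub = usual_filtration_subalgebra(1)[OF F grid0]
  have ad: "X k \<in> borel_measurable (F (grid h k))" "Xs k \<in> borel_measurable (F (grid h k))"
    "Y k \<in> borel_measurable (F (grid h k))" "Ys k \<in> borel_measurable (F (grid h k))" for k
    using X Y by (auto simp: ssbe_solution_def)
  have "\<psi> t \<in> borel_measurable (F 0)" "\<phi> t \<in> borel_measurable (F 0)" if "t \<in> {-\<tau>..0}" for t
    using \<psi> \<phi> that unfolding initial_datum_def by blast+
  then have adD: "DX k \<in> borel_measurable (F (grid h k))" "DY k \<in> borel_measurable (F (grid h k))" for k
    unfolding DX_def DY_def using ad by (intro ssbe_delayed_adapted[OF F h dl ip]; blast)+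
  note [measurable] = measurable_from_subalg[OF sub ad(1)] measurable_from_subalg[OF sub ad(2)]
    measurable_from_subalg[OF sub ad(3)] measurable_from_subalg[OF sub ad(4)]
    measurable_from_subalg[OF sub adD(1)] measurable_from_subalg[OF sub adD(2)]
  have [measurable]: "E k \<in> borel_measurable M" "S k \<in> borel_measurable M" "V k \<in> borel_measurable M" for k
    unfolding E_def S_def V_def by measurable
  have cont: "continuous_on {-\<tau>..0} (\<lambda>t. \<psi> t \<omega>)" "continuous_on {-\<tau>..0} (\<lambda>t. \<phi> t \<omega>)"
    if "\<omega> \<in> space M" for \<omega>
    using \<psi> \<phi> that unfolding initial_datum_def by blast+
  have "\<exists>\<theta> R. 0 \<le> \<theta> \<and> \<theta> \<le> 1 \<and> R \<in> borel_measurable M \<and> (\<forall>\<omega>. 0 \<le> R \<omega>) \<and>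
    (\<forall>\<omega>. E n \<omega> \<le> \<theta> * S n \<omega> + (1 - \<theta>) * R \<omega>) \<and>
    (\<forall>C. (\<forall>k. k < n \<longrightarrow> n \<le> k + \<kappa> \<longrightarrow> (\<integral>\<^sup>+\<omega>. ennreal (S k \<omega>) \<partial>M) \<le> C) \<longrightarrow>
      (n < \<kappa> \<longrightarrow> ennreal N \<le> C) \<longrightarrow> (\<integral>\<^sup>+\<omega>. ennreal (R \<omega>) \<partial>M) \<le> C)" for n
    unfolding S_def N(1)[symmetric]
    by (rule delayed_error_split[OF h \<kappa> dl ip cont]) (auto simp: E_def DX_def[symmetric] DY_def[symmetric] fun_eq_iff)
  then obtain \<theta> R where \<theta>: "\<And>n. 0 \<le> \<theta> n" "\<And>n. \<theta> n \<le> 1"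
    and R [measurable]: "\<And>n. R n \<in> borel_measurable M" and R0: "\<And>n \<omega>. 0 \<le> R n \<omega>"
    and ER: "\<And>n \<omega>. E n \<omega> \<le> \<theta> n * S n \<omega> + (1 - \<theta> n) * R n \<omega>"
    and window: "\<And>n C. (\<And>k. k < n \<Longrightarrow> n \<le> k + \<kappa> \<Longrightarrow> (\<integral>\<^sup>+\<omega>. ennreal (S k \<omega>) \<partial>M) \<le> C) \<Longrightarrow>
      (n < \<kappa> \<Longrightarrow> ennreal N \<le> C) \<Longrightarrow> (\<integral>\<^sup>+\<omega>. ennreal (R n \<omega>) \<partial>M) \<le> C"
    by metis
  have S0: "0 \<le> S n \<omega>" and V0: "0 \<le> V n \<omega>" and E0: "0 \<le> E n \<omega>" for n \<omega>
    by (auto simp: S_def V_def E_def)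
  have integrate: "(\<integral>\<^sup>+\<omega>. ennreal (b * B \<omega> + c * C \<omega>) \<partial>M)
      = ennreal b * (\<integral>\<^sup>+\<omega>. ennreal (B \<omega>) \<partial>M) + ennreal c * (\<integral>\<^sup>+\<omega>. ennreal (C \<omega>) \<partial>M)"
    if "0 \<le> b" "0 \<le> c" "B \<in> borel_measurable M" "C \<in> borel_measurable M"
      "\<And>\<omega>. 0 \<le> B \<omega>" "\<And>\<omega>. 0 \<le> C \<omega>" for b c and B C :: "'a \<Rightarrow> real"
    using that by (simp add: ennreal_mult nn_integral_add nn_integral_cmult)
  have hn: "0 \<le> h * \<gamma>2" "0 \<le> h * \<gamma>3" "0 \<le> h * \<gamma>4"
    using h nonneg by simp_all
  have "h * (2 * \<gamma>1 + 2 * \<gamma>2 + \<gamma>3 + \<gamma>4) < 0"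
    using h \<beta> by (simp add: mult_pos_neg)
  then have gap: "1 + h * \<gamma>2 + h * \<gamma>3 + h * \<gamma>4 < 1 - 2 * h * \<gamma>1 - h * \<gamma>2"
    by (simp add: algebra_simps)
  define a where "a = 1 - 2 * h * \<gamma>1 - h * \<gamma>2"
  \<comment> \<open>\<open>ennreal\<close> sends negative reals to zero, so the coefficient left on
    the stage term must be nonnegative before it is pulled out of the integral.\<close>
  have a\<theta>: "0 \<le> a - h * \<gamma>2 * \<theta> n" for n
    using gap hn mult_left_mono[OF \<theta>(2) hn(1), of n] unfolding a_def by linarith
  have "(\<integral>\<^sup>+\<omega>. ennreal (V n \<omega>) \<partial>M)
      \<le> ennreal ((1 + h * \<gamma>3 + h * \<gamma>4) * ((1 + h * \<gamma>2 + h * \<gamma>3 + h * \<gamma>4) / a) ^ (n div (\<kappa> + 1)) * N)"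
  proof (rule delayed_recursion_decay[where u = "\<lambda>n. \<integral>\<^sup>+\<omega>. ennreal (S n \<omega>) \<partial>M"
        and v = "\<lambda>n. \<integral>\<^sup>+\<omega>. ennreal (V n \<omega>) \<partial>M" and p = "\<lambda>n. \<integral>\<^sup>+\<omega>. ennreal (E n \<omega>) \<partial>M"
        and r = "\<lambda>n. \<integral>\<^sup>+\<omega>. ennreal (R n \<omega>) \<partial>M" and \<theta> = \<theta>, OF hn N(2) _ \<theta>])
    show "1 + h * \<gamma>2 + h * \<gamma>3 + h * \<gamma>4 < a" using gap by (simp add: a_def)
  next
    fix n
    have "AE \<omega> in M. (a - h * \<gamma>2 * \<theta> n) * S n \<omega> \<le> V n \<omega> + h * \<gamma>2 * (1 - \<theta> n) * R n \<omega>"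
    proof -
      have "AE \<omega> in M. Xs n \<omega> = X n \<omega> + h *\<^sub>R f (Xs n \<omega>) (DX n \<omega>)"
        "AE \<omega> in M. Ys n \<omega> = Y n \<omega> + h *\<^sub>R f (Ys n \<omega>) (DY n \<omega>)"
        using X Y by (auto simp: ssbe_solution_def DX_def DY_def)
      then show ?thesis
      proof eventually_elim
        case (elim \<omega>)
        have "a * S n \<omega> \<le> V n \<omega> + h * \<gamma>2 * E n \<omega>"
          unfolding a_def S_def V_def E_def
          by (rule implicit_stage_bound[OF one_sided lip_f h nonneg(1) elim])
        also have "\<dots> \<le> V n \<omega> + h * \<gamma>2 * (\<theta> n * S n \<omega> + (1 - \<theta> n) * R n \<omega>)"
          using mult_left_mono[OF ER hn(1)] by simp
        \<comment> \<open>The share \<open>\<theta> n * S n \<omega>\<close> moves to the left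
          pointwise, before integration, because possibly infinite integrals could not be
          subtracted.\<close>
        finally show ?case by (simp add: algebra_simps)
      qed
    qed
    \<comment> \<open>The summand \<open>0 * S n \<omega>\<close> and the factor \<open>1\<close>
      bring both sides into the two-term form of \<open>integrate\<close>.\<close>
    then have "(\<integral>\<^sup>+\<omega>. ennreal ((a - h * \<gamma>2 * \<theta> n) * S n \<omega> + 0 * S n \<omega>) \<partial>M)
        \<le> (\<integral>\<^sup>+\<omega>. ennreal (1 * V n \<omega> + (h * \<gamma>2 * (1 - \<theta> n)) * R n \<omega>) \<partial>M)"
      by (intro nn_integral_mono_AE) (auto intro: ennreal_leI)
    then show "ennreal (a - h * \<gamma>2 * \<theta> n) * (\<integral>\<^sup>+\<omega>. ennreal (S n \<omega>) \<partial>M)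
        \<le> (\<integral>\<^sup>+\<omega>. ennreal (V n \<omega>) \<partial>M) + ennreal (h * \<gamma>2 * (1 - \<theta> n)) * (\<integral>\<^sup>+\<omega>. ennreal (R n \<omega>) \<partial>M)"
      using a\<theta> hn \<theta> by (subst (asm) (1 2) integrate) (auto simp: S0 V0 R0)
  next
    fix n
    have "(\<integral>\<^sup>+\<omega>. ennreal (E n \<omega>) \<partial>M) \<le> (\<integral>\<^sup>+\<omega>. ennreal (\<theta> n * S n \<omega> + (1 - \<theta> n) * R n \<omega>) \<partial>M)"
      by (intro nn_integral_mono ennreal_leI ER)
    then show "(\<integral>\<^sup>+\<omega>. ennreal (E n \<omega>) \<partial>M)
        \<le> ennreal (\<theta> n) * (\<integral>\<^sup>+\<omega>. ennreal (S n \<omega>) \<partial>M) + ennreal (1 - \<theta> n) * (\<integral>\<^sup>+\<omega>. ennreal (R n \<omega>) \<partial>M)"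
      using \<theta> by (subst (asm) integrate) (auto simp: S0 R0)
  next
    have "AE \<omega> in M. X 0 \<omega> = \<psi> 0 \<omega>" "AE \<omega> in M. Y 0 \<omega> = \<phi> 0 \<omega>"
      using X Y by (auto simp: ssbe_solution_def)
    then have "AE \<omega> in M. V 0 \<omega> \<le> (path_norm \<tau> (\<lambda>s. \<phi> s \<omega> - \<psi> s \<omega>))\<^sup>2"
      using AE_space
    proof eventually_elim
      case (elim \<omega>)
      have "norm (\<phi> 0 \<omega> - \<psi> 0 \<omega>) \<le> path_norm \<tau> (\<lambda>s. \<phi> s \<omega> - \<psi> s \<omega>)"
        by (rule norm_le_path_norm[where u = "\<lambda>s. \<phi> s \<omega> - \<psi> s \<omega>"])
          (use \<tau> cont[OF elim(3)] in \<open>auto intro: continuous_on_diff\<close>)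
      then show ?case using elim by (simp add: V_def norm_minus_commute power_mono)
    qed
    then show "(\<integral>\<^sup>+\<omega>. ennreal (V 0 \<omega>) \<partial>M) \<le> ennreal N"
      unfolding N(1)[symmetric] mean_sq_def by (intro nn_integral_mono_AE) (auto intro: ennreal_leI)
  next
    fix n
    define Z where "Z \<omega> = w (grid h (Suc n)) \<omega> - w (grid h n) \<omega>" for \<omega>
    define G where "G \<omega> = g (Xs n \<omega>) (DX n \<omega>) - g (Ys n \<omega>) (DY n \<omega>)" for \<omega>
    have lt: "grid h n < grid h (Suc n)" and inc: "grid h (Suc n) - grid h n = h"
      using h by (simp_all add: grid_def algebra_simps)
    note mom = wiener_increment_moments[OF M W grid0 lt, folded Z_def, unfolded inc]
    have ind: "indep_set (sets (F (grid h n))) (sets (vimage_algebra (space M) Z borel))"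
      using W grid0[of n] lt unfolding wiener_process_def Z_def by blast
    have "w (grid h k) \<in> borel_measurable M" for k
      using W grid0[of k] measurable_from_subalg[OF sub] unfolding wiener_process_def by blast
    then have Z_meas: "Z \<in> borel_measurable M"
      unfolding Z_def by measurable
    have g_meas: "(\<lambda>p. g (fst p) (snd p)) \<in> borel_measurable borel"
      by (intro borel_measurable_continuous_onI continuous_of_sq_lipschitz[OF lip_g])
    \<comment> \<open>Measurability in \<open>F (grid h n)\<close>, not merely in \<open>M\<close>,
      is required: the increment is independent of that sigma-algebra.\<close>
    have G_meas: "G \<in> borel_measurable (F (grid h n))"
      unfolding G_def
      using measurable_compose[OF borel_measurable_Pair[OF ad(2) adD(1)] g_meas, of n]
        measurable_compose[OF borel_measurable_Pair[OF ad(4) adD(2)] g_meas, of n] by simp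
    have "AE \<omega> in M. X (Suc n) \<omega> = Xs n \<omega> + g (Xs n \<omega>) (DX n \<omega>) *v Z \<omega>"
      "AE \<omega> in M. Y (Suc n) \<omega> = Ys n \<omega> + g (Ys n \<omega>) (DY n \<omega>) *v Z \<omega>"
      using X Y by (auto simp: ssbe_solution_def DX_def DY_def Z_def)
    then have "AE \<omega> in M. V (Suc n) \<omega> = (norm ((Xs n \<omega> - Ys n \<omega>) + G \<omega> *v Z \<omega>))\<^sup>2"
      by eventually_elim (simp add: V_def G_def matrix_vector_mult_diff_rdistrib algebra_simps)
    then have "(\<integral>\<^sup>+\<omega>. ennreal (V (Suc n) \<omega>) \<partial>M)
        = (\<integral>\<^sup>+\<omega>. ennreal ((norm ((Xs n \<omega> - Ys n \<omega>) + G \<omega> *v Z \<omega>))\<^sup>2) \<partial>M)"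
      by (intro nn_integral_cong_AE) auto
    also have "\<dots> \<le> (\<integral>\<^sup>+\<omega>. ennreal ((norm (Xs n \<omega> - Ys n \<omega>))\<^sup>2) \<partial>M)
        + ennreal h * (\<integral>\<^sup>+\<omega>. ennreal ((norm (G \<omega>))\<^sup>2) \<partial>M)"
      by (rule nn_integral_norm_sq_add_indep[OF ind sub Z_meas _ G_meas mom h])
        (intro borel_measurable_diff ad)
    also have "\<dots> \<le> (\<integral>\<^sup>+\<omega>. ennreal (S n \<omega>) \<partial>M)
        + ennreal h * (\<integral>\<^sup>+\<omega>. ennreal (\<gamma>3 * S n \<omega> + \<gamma>4 * E n \<omega>) \<partial>M)"
      unfolding G_def S_def E_def
      by (intro add_mono mult_left_mono nn_integral_mono ennreal_leI lip_g) auto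
    also have "\<dots> = ennreal (1 + h * \<gamma>3) * (\<integral>\<^sup>+\<omega>. ennreal (S n \<omega>) \<partial>M)
        + ennreal (h * \<gamma>4) * (\<integral>\<^sup>+\<omega>. ennreal (E n \<omega>) \<partial>M)"
      using h nonneg hn S0 E0
      by (subst integrate) (auto simp: ennreal_mult ennreal_plus distrib_left distrib_right mult.assoc add.assoc)
    finally show "(\<integral>\<^sup>+\<omega>. ennreal (V (Suc n) \<omega>) \<partial>M)
        \<le> ennreal (1 + h * \<gamma>3) * (\<integral>\<^sup>+\<omega>. ennreal (S n \<omega>) \<partial>M)
        + ennreal (h * \<gamma>4) * (\<integral>\<^sup>+\<omega>. ennreal (E n \<omega>) \<partial>M)" .
  qed (use window in auto)
  then show ?thesis by (simp add: mean_sq_def V_def a_def)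
qed

section \<open>Passage to the halved exponential rate\<close>

theorem theorem4p2:
  fixes M :: "'a measure" and F :: "real \<Rightarrow> 'a measure"
    and w :: "real \<Rightarrow> 'a \<Rightarrow> real^'m"
    and f :: "real^'d \<Rightarrow> real^'d \<Rightarrow> real^'d"
    and g :: "real^'d \<Rightarrow> real^'d \<Rightarrow> real^'m^'d"
    and \<gamma>1 \<gamma>2 \<gamma>3 \<gamma>4 \<tau> h \<delta> :: real and \<kappa> :: nat
    and dl :: "real \<Rightarrow> real"
  assumes "prob_space M" and "usual_filtration M F" and "wiener_process M F w"
    and "cont_diff f"
    and "\<And>x1 x2 y. (x2 - x1) \<bullet> (f x2 y - f x1 y) \<le> \<gamma>1 * (norm (x2 - x1))\<^sup>2"
    and "\<And>x y1 y2. norm (f x y2 - f x y1) \<le> \<gamma>2 * norm (y2 - y1)"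
    and "\<And>x1 x2 y1 y2. (norm (g x2 y2 - g x1 y1))\<^sup>2
           \<le> \<gamma>3 * (norm (x2 - x1))\<^sup>2 + \<gamma>4 * (norm (y2 - y1))\<^sup>2"
    and "\<tau> > 0" and "\<And>t. t \<ge> 0 \<Longrightarrow> 0 \<le> dl t \<and> dl t \<le> \<tau>"
    and "2 * \<gamma>1 + 2 * \<gamma>2 + \<gamma>3 + \<gamma>4 < 0"
    and "h > 0" and "\<kappa> \<ge> 1" and "0 \<le> \<delta>" and "\<delta> < 1" and "\<tau> = (real \<kappa> - \<delta>) * h"
  shows "nu_plus h \<kappa> \<gamma>1 \<gamma>2 \<gamma>3 \<gamma>4 > 0 \<and>
    (\<forall>(q :: nat \<Rightarrow> nat) (\<mu> :: nat \<Rightarrow> real) (\<psi> :: real \<Rightarrow> 'a \<Rightarrow> real^'d) (\<phi> :: real \<Rightarrow> 'a \<Rightarrow> real^'d)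
       (X :: nat \<Rightarrow> 'a \<Rightarrow> real^'d) (Xs :: nat \<Rightarrow> 'a \<Rightarrow> real^'d)
       (Y :: nat \<Rightarrow> 'a \<Rightarrow> real^'d) (Ys :: nat \<Rightarrow> 'a \<Rightarrow> real^'d).
       interpolation h dl q \<mu> \<and>
       initial_datum M F w \<tau> \<psi> \<and> initial_datum M F w \<tau> \<phi> \<and>
       mean_sq M (\<lambda>\<omega>. path_norm \<tau> (\<lambda>s. \<psi> s \<omega>)) < \<infinity> \<and>
       mean_sq M (\<lambda>\<omega>. path_norm \<tau> (\<lambda>s. \<phi> s \<omega>)) < \<infinity> \<and>
       ssbe_solution M F f g w h dl q \<mu> \<psi> X Xs \<and>
       ssbe_solution M F f g w h dl q \<mu> \<phi> Y Ys \<longrightarrow>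
       (\<forall>\<^sub>F n in sequentially.
          mean_sq M (\<lambda>\<omega>. norm (X n \<omega> - Y n \<omega>))
            \<le> mean_sq M (\<lambda>\<omega>. path_norm \<tau> (\<lambda>s. \<phi> s \<omega> - \<psi> s \<omega>))
               * ennreal (exp (- nu_plus h \<kappa> \<gamma>1 \<gamma>2 \<gamma>3 \<gamma>4 * real n * h))))"
proof -
  \<comment> \<open>The signs come from testing the Lipschitz conditions at the zero vector and the
    all-ones vector, whose norm is positive.\<close>
  have nonneg: "0 \<le> \<gamma>2" "0 \<le> \<gamma>3" "0 \<le> \<gamma>4"
  proof -
    have pos: "0 < norm (1 :: real^'d)" by simp
    have "0 \<le> \<gamma>2 * norm (1 :: real^'d)"
      using order_trans[OF norm_ge_zero assms(6)[of 0 1 0]] by simp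
    then show "0 \<le> \<gamma>2" using pos by (simp add: zero_le_mult_iff)
    have "0 \<le> \<gamma>3 * (norm (1 :: real^'d))\<^sup>2"
      using order_trans[OF zero_le_power2 assms(7)[of 1 0 0 0]] by simp
    then show "0 \<le> \<gamma>3" using pos by (simp add: zero_le_mult_iff)
    have "0 \<le> \<gamma>4 * (norm (1 :: real^'d))\<^sup>2"
      using order_trans[OF zero_le_power2 assms(7)[of 0 1 0 0]] by simp
    then show "0 \<le> \<gamma>4" using pos by (simp add: zero_le_mult_iff)
  qed
  define a where "a = 1 - 2 * h * \<gamma>1 - h * \<gamma>2"
  define b where "b = 1 + h * \<gamma>2 + h * \<gamma>3 + h * \<gamma>4"
  have hn: "0 \<le> h * \<gamma>2" "0 \<le> h * \<gamma>3" "0 \<le> h * \<gamma>4"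
    using \<open>h > 0\<close> nonneg by simp_all
  \<comment> \<open>This product is \<open>b - a\<close>, so \<open>a / b\<close> exceeds one and
    its logarithm is positive for every step size.\<close>
  have "h * (2 * \<gamma>1 + 2 * \<gamma>2 + \<gamma>3 + \<gamma>4) < 0"
    using assms(10,11) by (simp add: mult_pos_neg)
  then have ba: "b < a" by (simp add: a_def b_def algebra_simps)
  have b: "0 < b" using hn by (simp add: b_def)
  have \<nu>: "nu_plus h \<kappa> \<gamma>1 \<gamma>2 \<gamma>3 \<gamma>4 = 1 / (2 * (real \<kappa> + 1) * h) * ln (a / b)"
    by (simp add: nu_plus_def a_def b_def)
  have pos: "nu_plus h \<kappa> \<gamma>1 \<gamma>2 \<gamma>3 \<gamma>4 > 0"
    unfolding \<nu> using ba b \<open>h > 0\<close> by simp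
  show ?thesis
  proof (intro conjI pos allI impI)
    fix q :: "nat \<Rightarrow> nat" and \<mu> :: "nat \<Rightarrow> real" and \<psi> \<phi> :: "real \<Rightarrow> 'a \<Rightarrow> real^'d"
      and X Xs Y Ys :: "nat \<Rightarrow> 'a \<Rightarrow> real^'d"
    assume sol: "interpolation h dl q \<mu> \<and>
       initial_datum M F w \<tau> \<psi> \<and> initial_datum M F w \<tau> \<phi> \<and>
       mean_sq M (\<lambda>\<omega>. path_norm \<tau> (\<lambda>s. \<psi> s \<omega>)) < \<infinity> \<and>
       mean_sq M (\<lambda>\<omega>. path_norm \<tau> (\<lambda>s. \<phi> s \<omega>)) < \<infinity> \<and>
       ssbe_solution M F f g w h dl q \<mu> \<psi> X Xs \<and>
       ssbe_solution M F f g w h dl q \<mu> \<phi> Y Ys"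
    let ?N = "mean_sq M (\<lambda>\<omega>. path_norm \<tau> (\<lambda>s. \<phi> s \<omega> - \<psi> s \<omega>))"
    show "\<forall>\<^sub>F n in sequentially. mean_sq M (\<lambda>\<omega>. norm (X n \<omega> - Y n \<omega>))
            \<le> ?N * ennreal (exp (- nu_plus h \<kappa> \<gamma>1 \<gamma>2 \<gamma>3 \<gamma>4 * real n * h))"
    proof (cases ?N)
      case top
      \<comment> \<open>An infinite initial mean square makes the right side infinite, the
        exponential being positive.\<close>
      then show ?thesis by (simp add: ennreal_top_mult)
    next
      case (real N)
      \<comment> \<open>This prefactor of the decay bound is the constant traded for half of the
        rate. Since \<open>N\<close> is a common factor, the index from which the bound holds does
        not depend on the initial data.\<close>
      have "0 < 1 + h * \<gamma>3 + h * \<gamma>4" using hn by simp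
      from eventually_power_div_le_exp[OF b ba this \<open>h > 0\<close>, of \<kappa>] show ?thesis
      proof eventually_elim
        case (elim n)
        have "mean_sq M (\<lambda>\<omega>. norm (X n \<omega> - Y n \<omega>))
            \<le> ennreal ((1 + h * \<gamma>3 + h * \<gamma>4) * (b / a) ^ (n div (\<kappa> + 1)) * N)"
          unfolding a_def b_def
          by (rule ssbe_mean_sq_decay[OF assms(1,2,3,5,6,7) nonneg assms(9,10,11,8,12,13,15)])
            (use sol real in auto)
        also have "\<dots> \<le> ennreal (exp (- nu_plus h \<kappa> \<gamma>1 \<gamma>2 \<gamma>3 \<gamma>4 * real n * h) * N)"
          using elim real unfolding \<nu> by (intro ennreal_leI mult_right_mono)
        also have "\<dots> = ?N * ennreal (exp (- nu_plus h \<kappa> \<gamma>1 \<gamma>2 \<gamma>3 \<gamma>4 * real n * h))"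
          using real by (simp add: ennreal_mult mult.commute)
        finally show ?case .
      qed
    qed
  qed
qed

end
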